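(* Let $G$ be a finite group. Then $G$ is autonilpotent if and only if $\mathrm{Aut}\,G$ stabilizes some chain of subgroups of $G$.
   Context: All groups are finite. $\mathrm{Aut}\,G$ is the group of all automorphisms of $G$. For $x\in G$ and $\alpha\in\mathrm{Aut}\,G$, $x^\alpha$ denotes the image of $x$ under $\alpha$, $[x,\alpha]=x^{-1}x^\alpha$, and inductively $[x,\alpha_1,\dots,\alpha_n]=[[x,\alpha_1,\dots,\alpha_{n-1}],\alpha_n]$. For a natural number $n$ let $L_n(G)=\{x\in G \mid [x,\alpha_1,\dots,\alpha_n]=1 \text{ for all } \alpha_1,\dots,\alpha_n\in\mathrm{Aut}\,G\}$. The group $G$ is called autonilpotent if $G=L_n(G)$ for some natural number $n$. A group $A$ of automorphisms of $G$ stabilizes a chain of subgroups $1=G_n\le G_{n-1}\le\dots\le G_0=G$ (the $G_i$ are not assumed normal in $G$) if $x^\alpha G_{i+1}=xG_{i+1}$ for all $0\le i<n$, all $x\in G_i$ and all $\alpha\in A$. *)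

theory Defs
  imports "HOL-Algebra.Coset" "HOL-Algebra.Bij"
begin

definition autocomm :: "('a, 'b) monoid_scheme \<Rightarrow> 'a \<Rightarrow> ('a \<Rightarrow> 'a) \<Rightarrow> 'a" where
  "autocomm G x \<alpha> = inv\<^bsub>G\<^esub> x \<otimes>\<^bsub>G\<^esub> \<alpha> x"

text \<open>The list \<open>[\<alpha>\<^sub>1, \<dots>, \<alpha>\<^sub>n]\<close> yields the left-normed commutator \<open>[x, \<alpha>\<^sub>1, \<dots>, \<alpha>\<^sub>n]\<close>,
  which is \<open>x\<close> itself for \<open>n = 0\<close>.\<close>

definition iter_autocomm :: "('a, 'b) monoid_scheme \<Rightarrow> 'a \<Rightarrow> ('a \<Rightarrow> 'a) list \<Rightarrow> 'a" where
  "iter_autocomm G x \<alpha>s = foldl (autocomm G) x \<alpha>s"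

text \<open>The set \<open>auto G\<close> is the carrier of \<open>AutoGroup G\<close>; its elements are extensional functions on
  \<open>carrier G\<close>, so each automorphism is represented exactly once.\<close>

definition autocentre :: "nat \<Rightarrow> ('a, 'b) monoid_scheme \<Rightarrow> 'a set" where
  "autocentre n G = {x \<in> carrier G. \<forall>\<alpha>s. length \<alpha>s = n \<and> set \<alpha>s \<subseteq> auto G
      \<longrightarrow> iter_autocomm G x \<alpha>s = \<one>\<^bsub>G\<^esub>}"

text \<open>Admitting \<open>n = 0\<close> is harmless: \<open>autocentre 0 G = {\<one>\<^bsub>G\<^esub>}\<close>, so it only concerns the trivial
  group, which also satisfies the condition for \<open>n = 1\<close>.\<close>

definition autonilpotent :: "('a, 'b) monoid_scheme \<Rightarrow> bool" where
  "autonilpotent G \<longleftrightarrow> (\<exists>n. carrier G = autocentre n G)"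

text \<open>A chain of length \<open>n\<close> is given by its terms \<open>C 0, \<dots>, C n\<close>; values of \<open>C\<close> beyond \<open>n\<close> are
  irrelevant. Inclusions need not be proper.\<close>

definition subgroup_chain :: "('a, 'b) monoid_scheme \<Rightarrow> nat \<Rightarrow> (nat \<Rightarrow> 'a set) \<Rightarrow> bool" where
  "subgroup_chain G n C \<longleftrightarrow>
     C 0 = carrier G \<and> C n = {\<one>\<^bsub>G\<^esub>} \<and>
     (\<forall>i\<le>n. subgroup (C i) G) \<and> (\<forall>i<n. C (Suc i) \<subseteq> C i)"

definition stabilizes_chain ::
    "('a, 'b) monoid_scheme \<Rightarrow> ('a \<Rightarrow> 'a) set \<Rightarrow> nat \<Rightarrow> (nat \<Rightarrow> 'a set) \<Rightarrow> bool" where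
  "stabilizes_chain G A n C \<longleftrightarrow>
     (\<forall>i<n. \<forall>x \<in> C i. \<forall>\<alpha> \<in> A. \<alpha> x <#\<^bsub>G\<^esub> C (Suc i) = x <#\<^bsub>G\<^esub> C (Suc i))"

end

theory Submission
  imports Defs
begin

text \<open>Both properties say that iterated autocommutators descend through a finite tower of subgroups,
  because \<open>\<alpha> x H = x H\<close> means \<open>[x, \<alpha>] \<in> H\<close>. If a chain is stabilized, each further autocommutation
  moves an element at least one step down, so \<open>n\<close> of them lead to the trivial group.

  Conversely, the tower of sets \<open>L\<^sub>n(G) = autocentre n G\<close>, read downwards, is stabilized by
  construction; what has to be shown is that its members are subgroups. This is clear once \<open>L\<^sub>n(G)\<close>
  is known to be normal, since then \<open>L\<^sub>n\<^sub>+\<^sub>1(G)\<close> consists of the \<open>x\<close> whose coset modulo \<open>L\<^sub>n(G)\<close> is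
  fixed by every automorphism. Normality passes to \<open>L\<^sub>n\<^sub>+\<^sub>1(G)\<close> because inner automorphisms are
  automorphisms: a conjugate of \<open>x\<close> has the form \<open>x [x, \<alpha>]\<close> with \<open>[x, \<alpha>] \<in> L\<^sub>n(G) \<subseteq> L\<^sub>n\<^sub>+\<^sub>1(G)\<close>
  (lemma \<open>normal_autocentre\<close>).\<close>

context group
begin

lemma auto_closed: "\<alpha> \<in> auto G \<Longrightarrow> x \<in> carrier G \<Longrightarrow> \<alpha> x \<in> carrier G"
  by (auto simp: auto_def hom_def)

lemma auto_mult:
  "\<alpha> \<in> auto G \<Longrightarrow> x \<in> carrier G \<Longrightarrow> y \<in> carrier G \<Longrightarrow> \<alpha> (x \<otimes> y) = \<alpha> x \<otimes> \<alpha> y"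
  by (auto simp: auto_def hom_def)

lemma auto_group_hom: "\<alpha> \<in> auto G \<Longrightarrow> group_hom G G \<alpha>"
  by (auto simp: auto_def group_hom_def group_hom_axioms_def)

lemma autocomm_closed: "\<alpha> \<in> auto G \<Longrightarrow> x \<in> carrier G \<Longrightarrow> autocomm G x \<alpha> \<in> carrier G"
  by (simp add: autocomm_def auto_closed)

lemma mult_autocomm:
  assumes "\<alpha> \<in> auto G" "x \<in> carrier G"
  shows "x \<otimes> autocomm G x \<alpha> = \<alpha> x"
  using assms by (simp add: autocomm_def auto_closed flip: m_assoc)

lemma autocomm_one: "\<alpha> \<in> auto G \<Longrightarrow> autocomm G \<one> \<alpha> = \<one>"
  by (simp add: autocomm_def group_hom.hom_one[OF auto_group_hom])

lemma autocomm_mult: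
  assumes "\<alpha> \<in> auto G" "x \<in> carrier G" "y \<in> carrier G"
  shows "autocomm G (x \<otimes> y) \<alpha> = (inv y \<otimes> autocomm G x \<alpha> \<otimes> y) \<otimes> autocomm G y \<alpha>"
proof -
  have "(inv y \<otimes> autocomm G x \<alpha> \<otimes> y) \<otimes> autocomm G y \<alpha> = inv y \<otimes> autocomm G x \<alpha> \<otimes> \<alpha> y"
    using assms by (simp add: m_assoc autocomm_closed mult_autocomm auto_closed)
  then show ?thesis
    using assms by (simp add: autocomm_def auto_mult auto_closed inv_mult_group m_assoc)
qed

lemma autocomm_inv:
  assumes "\<alpha> \<in> auto G" "x \<in> carrier G"
  shows "autocomm G (inv x) \<alpha> = x \<otimes> inv (autocomm G x \<alpha>) \<otimes> inv x"
  using assms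
  by (simp add: autocomm_def group_hom.hom_inv[OF auto_group_hom] auto_closed inv_mult_group m_assoc)

lemma l_coset_auto_eq_iff:
  assumes "subgroup H G" "\<alpha> \<in> auto G" "x \<in> carrier G"
  shows "\<alpha> x <# H = x <# H \<longleftrightarrow> autocomm G x \<alpha> \<in> H"
proof
  assume "\<alpha> x <# H = x <# H"
  moreover have "\<alpha> x \<in> \<alpha> x <# H"
    using assms(2,3) subgroup.one_closed[OF assms(1)] by (force simp: l_coset_def auto_closed)
  ultimately obtain h where "h \<in> H" "\<alpha> x = x \<otimes> h"
    by (auto simp: l_coset_def)
  moreover from this have "h \<in> carrier G"
    by (simp add: subgroup.mem_carrier[OF assms(1)])
  ultimately show "autocomm G x \<alpha> \<in> H"
    using assms by (simp add: autocomm_def flip: m_assoc)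
next
  assume "autocomm G x \<alpha> \<in> H"
  then have "\<alpha> x \<in> x <# H"
    using mult_autocomm[OF assms(2,3)] unfolding l_coset_def by force
  then show "\<alpha> x <# H = x <# H"
    using l_repr_independence[OF _ assms(3,1)] by simp
qed

lemma conjugation_in_auto:
  assumes g: "g \<in> carrier G"
  shows "(\<lambda>x\<in>carrier G. g \<otimes> x \<otimes> inv g) \<in> auto G"
proof -
  let ?c = "\<lambda>x\<in>carrier G. g \<otimes> x \<otimes> inv g"
  have cancel: "inv g \<otimes> (g \<otimes> x) = x" "g \<otimes> (inv g \<otimes> x) = x" if "x \<in> carrier G" for x
    using g that by (simp_all flip: m_assoc)
  have "bij_betw ?c (carrier G) (carrier G)"
    by (rule bij_betwI[where g = "\<lambda>x. inv g \<otimes> x \<otimes> g"]) (use g in \<open>auto simp: m_assoc cancel\<close>)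
  moreover have "?c \<in> hom G G"
    using g by (auto simp: hom_def m_assoc cancel)
  ultimately show ?thesis
    by (simp add: auto_def Bij_def)
qed

lemma autocentre_0: "autocentre 0 G = {\<one>}"
  by (auto simp: autocentre_def iter_autocomm_def)

text \<open>Splitting off the first automorphism of the list makes membership a recursion on \<open>n\<close>, in
  the form needed for inductions in which \<open>x\<close> is replaced by \<open>[x, \<alpha>]\<close>.\<close>

lemma in_autocentre_Suc_iff:
  "x \<in> autocentre (Suc n) G \<longleftrightarrow> x \<in> carrier G \<and> (\<forall>\<alpha>\<in>auto G. autocomm G x \<alpha> \<in> autocentre n G)"
proof -
  have "(\<forall>\<alpha>s. length \<alpha>s = Suc n \<and> set \<alpha>s \<subseteq> auto G \<longrightarrow> P \<alpha>s) \<longleftrightarrow>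
      (\<forall>\<alpha>\<in>auto G. \<forall>\<alpha>s. length \<alpha>s = n \<and> set \<alpha>s \<subseteq> auto G \<longrightarrow> P (\<alpha> # \<alpha>s))" for P
    by (auto simp: length_Suc_conv)
  then show ?thesis
    by (auto simp: autocentre_def iter_autocomm_def autocomm_closed)
qed

lemma autocentre_mono_Suc: "autocentre n G \<subseteq> autocentre (Suc n) G"
proof (induction n)
  case 0
  show ?case
    by (auto simp: autocentre_0 in_autocentre_Suc_iff autocomm_one)
next
  case (Suc n)
  show ?case
  proof
    fix x assume "x \<in> autocentre (Suc n) G"
    with Suc show "x \<in> autocentre (Suc (Suc n)) G"
      by (subst in_autocentre_Suc_iff) (auto simp only: in_autocentre_Suc_iff[of x n])
  qed
qed

text \<open>Being a subgroup and being normal must be proved together: closure of \<open>L\<^sub>n\<^sub>+\<^sub>1(G)\<close> under products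
  and inverses needs \<open>[x y, \<alpha>] = [x, \<alpha>]\<^sup>y [y, \<alpha>]\<close> and its analogue for inverses, in which a conjugate
  of an element of \<open>L\<^sub>n(G)\<close> occurs.\<close>

lemma normal_autocentre: "autocentre n G \<lhd> G"
proof (induction n)
  case 0
  show ?case
    by (simp add: autocentre_0 one_is_normal)
next
  case (Suc n)
  let ?L = "autocentre n G" and ?M = "autocentre (Suc n) G"
  interpret L: normal ?L G by (rule Suc.IH)
  have "subgroup ?M G"
  proof (rule subgroupI)
    show "?M \<subseteq> carrier G"
      unfolding autocentre_def by (rule Collect_restrict)
    show "?M \<noteq> {}"
      using subsetD[OF autocentre_mono_Suc L.one_closed] by fast
  next
    fix x assume "x \<in> ?M"
    then show "inv x \<in> ?M"
      by (simp add: in_autocentre_Suc_iff autocomm_inv L.inv_op_closed2)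
  next
    fix x y assume "x \<in> ?M" "y \<in> ?M"
    then show "x \<otimes> y \<in> ?M"
      by (simp add: in_autocentre_Suc_iff autocomm_mult L.inv_op_closed1)
  qed
  moreover have "g \<otimes> x \<otimes> inv g \<in> ?M" if g: "g \<in> carrier G" and x: "x \<in> ?M" for g x
  proof -
    let ?c = "\<lambda>x\<in>carrier G. g \<otimes> x \<otimes> inv g"
    have xG: "x \<in> carrier G"
      using x by (simp add: in_autocentre_Suc_iff)
    have "autocomm G x ?c \<in> ?M"
      using x conjugation_in_auto[OF g] autocentre_mono_Suc[of n]
      unfolding in_autocentre_Suc_iff[of x] by (meson subsetD)
    then have "x \<otimes> autocomm G x ?c \<in> ?M"
      by (rule subgroup.m_closed[OF \<open>subgroup ?M G\<close> x])
    then show ?thesis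
      using xG by (simp add: mult_autocomm[OF conjugation_in_auto[OF g]])
  qed
  ultimately show ?case
    by (simp add: normal_inv_iff)
qed

lemma autonilpotent_imp_stabilizes_chain:
  assumes "autonilpotent G"
  shows "\<exists>n C. subgroup_chain G n C \<and> stabilizes_chain G (auto G) n C"
proof -
  obtain n where n: "autocentre n G = carrier G"
    using assms by (auto simp: autonilpotent_def)
  define C where "C i = autocentre (n - i) G" for i
  have sub: "subgroup (autocentre k G) G" for k
    using normal_autocentre normal_imp_subgroup by blast
  have step: "C i = autocentre (Suc (n - Suc i)) G" if "i < n" for i
    using that by (simp add: C_def Suc_diff_Suc)
  have "C (Suc i) \<subseteq> C i" if "i < n" for i
    using autocentre_mono_Suc step[OF that] by (simp add: C_def)
  then have "subgroup_chain G n C"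
    by (simp add: subgroup_chain_def C_def n autocentre_0 sub)
  moreover have "stabilizes_chain G (auto G) n C"
    unfolding stabilizes_chain_def
  proof (intro allI impI ballI)
    fix i x \<alpha> assume "i < n" "x \<in> C i" "\<alpha> \<in> auto G"
    then show "\<alpha> x <# C (Suc i) = x <# C (Suc i)"
      by (simp add: step in_autocentre_Suc_iff C_def[of "Suc i"] l_coset_auto_eq_iff sub)
  qed
  ultimately show ?thesis by blast
qed

text \<open>The recursion for \<open>L\<^sub>k(G)\<close> starts at the trivial group, so the chain is compared with it from
  the bottom: autocommutation moves the elements of one term into the next smaller one, which
  the induction hypothesis has already placed in \<open>L\<^sub>k(G)\<close>.\<close>

lemma stabilized_chain_subset_autocentre:
  assumes "subgroup_chain G n C" "stabilizes_chain G (auto G) n C" "k \<le> n"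
  shows "C (n - k) \<subseteq> autocentre k G"
  using \<open>k \<le> n\<close>
proof (induction k)
  case 0
  show ?case
    using assms(1) by (simp add: subgroup_chain_def autocentre_0)
next
  case (Suc k)
  have n: "Suc (n - Suc k) = n - k" "n - Suc k < n"
    using Suc.prems by auto
  have sub: "subgroup (C (n - k)) G" "subgroup (C (n - Suc k)) G"
    using assms(1) by (auto simp: subgroup_chain_def)
  show ?case
  proof
    fix x assume x: "x \<in> C (n - Suc k)"
    then have xG: "x \<in> carrier G"
      by (rule subgroup.mem_carrier[OF sub(2)])
    have "autocomm G x \<alpha> \<in> C (n - k)" if \<alpha>: "\<alpha> \<in> auto G" for \<alpha>
    proof -
      have "\<alpha> x <# C (n - k) = x <# C (n - k)"
        using assms(2) n(2) x \<alpha> unfolding stabilizes_chain_def n(1)[symmetric] by blast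
      then show ?thesis
        using l_coset_auto_eq_iff[OF sub(1) \<alpha> xG] by simp
    qed
    then show "x \<in> autocentre (Suc k) G"
      using Suc xG by (auto simp: in_autocentre_Suc_iff)
  qed
qed

lemma stabilizes_chain_imp_autonilpotent:
  assumes "subgroup_chain G n C" "stabilizes_chain G (auto G) n C"
  shows "autonilpotent G"
proof -
  have "carrier G \<subseteq> autocentre n G"
    using stabilized_chain_subset_autocentre[OF assms order_refl] assms(1)
    by (simp add: subgroup_chain_def)
  then show ?thesis
    by (auto simp: autonilpotent_def autocentre_def)
qed

end

theorem theorem1p1:
  fixes G :: "('a, 'b) monoid_scheme"
  assumes "group G" and "finite (carrier G)"
  shows "autonilpotent G \<longleftrightarrow>
    (\<exists>n C. subgroup_chain G n C \<and> stabilizes_chain G (carrier (AutoGroup G)) n C)"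
proof -
  have "carrier (AutoGroup G) = auto G"
    by (simp add: AutoGroup_def)
  then show ?thesis
    using group.autonilpotent_imp_stabilizes_chain[OF assms(1)]
      group.stabilizes_chain_imp_autonilpotent[OF assms(1)] by auto
qed

end
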